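(* Let $f(n)$ be the number of equivalence classes of the relation $\sim$ on $\mathfrak{S}_n$ for $n\ge 1$, and set $f(0)=1$. Then $$f(n)=\sum_{j=0}^{\lfloor n/2\rfloor}(-1)^j\,(n-j)!\binom{n-j}{j}.$$ Equivalently, as formal power series, $$\sum_{n\ge 0}f(n)x^n=\sum_{m\ge 0}m!\,\bigl(x(1-x)\bigr)^m.$$
   Context: Permutations $w\in\mathfrak{S}_n$ are regarded as words $a_1a_2\cdots a_n$. Two permutations $u,v\in\mathfrak{S}_n$ are equivalent, $u\sim v$, if $v$ can be obtained from $u$ by a sequence of interchanges of two adjacent entries $a_i,a_{i+1}$ satisfying $|a_i-a_{i+1}|=1$. *)

theory Defs
  imports
    "HOL-Combinatorics.Multiset_Permutations"
    "HOL-Computational_Algebra.Formal_Power_Series"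
begin

abbreviation perm_words :: "nat \<Rightarrow> nat list set" where
  "perm_words n \<equiv> permutations_of_set {1..n}"

inductive adj_swap :: "nat list \<Rightarrow> nat list \<Rightarrow> bool" where
  "\<bar>int a - int b\<bar> = 1 \<Longrightarrow> adj_swap (xs @ a # b # ys) (xs @ b # a # ys)"

definition swap_equiv :: "nat \<Rightarrow> (nat list \<times> nat list) set" where
  "swap_equiv n = {(u, v). u \<in> perm_words n \<and> v \<in> perm_words n \<and> adj_swap\<^sup>*\<^sup>* u v}"

definition num_classes :: "nat \<Rightarrow> nat" where
  "num_classes n = (if n = 0 then 1 else card (perm_words n // swap_equiv n))"

lemma adj_swap_sym: "adj_swap u v \<Longrightarrow> adj_swap v u"
  by (induction rule: adj_swap.induct) (rule adj_swap.intros, linarith)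

lemma equiv_swap_equiv: "equiv (perm_words n) (swap_equiv n)"
proof (rule equivI)
  have "symp adj_swap\<^sup>*\<^sup>*"
    by (rule symp_rtranclp, rule sympI, rule adj_swap_sym)
  then show "sym (swap_equiv n)"
    unfolding swap_equiv_def sym_def by (blast dest: sympD)
  show "refl_on (perm_words n) (swap_equiv n)"
    by (auto simp: swap_equiv_def refl_on_def)
  show "trans (swap_equiv n)"
    unfolding swap_equiv_def trans_def by (blast dest: rtranclp_trans)
  show "swap_equiv n \<subseteq> perm_words n \<times> perm_words n"
    by (auto simp: swap_equiv_def)
qed

end

theory Submission
  imports Defs
begin

text \<open>
  The equivalence classes are the multilinear elements of a partially commutative monoid in
  which exactly consecutive integers commute, and the formula is the Cartier--Foata inversion
  for it. Classes of arrangements of a finite set \<open>A\<close> are counted by inclusion--exclusion over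
  the set of letters that can be moved to the front. This set is always \<open>{x}\<close> or
  \<open>{x, x + 1}\<close>, so the number \<open>F A\<close> of classes satisfies
  \<open>F A = (\<Sum>x. F (A - {x})) - (\<Sum>x. F (A - {x, x + 1}))\<close>.
  The signed sum over matchings \<open>M\<close> of the path graph on \<open>A\<close> of \<open>(|A| - |M|)!\<close> obeys the same
  recursion, and \<open>{1..n}\<close> has \<open>(n - j) choose j\<close> matchings with \<open>j\<close> edges.
\<close>

section \<open>A complete invariant of the equivalence classes\<close>

definition consecutive :: "nat \<Rightarrow> nat \<Rightarrow> bool" where
  "consecutive x y \<longleftrightarrow> x = Suc y \<or> y = Suc x"

lemma consecutive_commute: "consecutive x y \<longleftrightarrow> consecutive y x"
  by (auto simp: consecutive_def)

lemma consecutive_iff_abs: "consecutive x y \<longleftrightarrow> \<bar>int x - int y\<bar> = 1"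
  by (auto simp: consecutive_def)

text \<open>
  The ordered pairs of non-commuting letters form a complete invariant of a word without
  repeated letters, so they serve as a model of its equivalence class.
\<close>

fun fixed_pairs :: "nat list \<Rightarrow> (nat \<times> nat) set" where
  "fixed_pairs [] = {}"
| "fixed_pairs (x # xs) = {(x, y) | y. y \<in> set xs \<and> \<not> consecutive x y} \<union> fixed_pairs xs"

lemma fixed_pairs_append:
  "fixed_pairs (xs @ ys) =
     fixed_pairs xs \<union> fixed_pairs ys \<union> {(x, y). x \<in> set xs \<and> y \<in> set ys \<and> \<not> consecutive x y}"
  by (induction xs) auto

lemma fixed_pairsD:
  "(x, y) \<in> fixed_pairs w \<Longrightarrow> x \<in> set w \<and> y \<in> set w \<and> \<not> consecutive x y"
  by (induction w) auto

lemma fixed_pairs_filter: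
  "fixed_pairs (filter P w) = fixed_pairs w \<inter> {(x, y). P x \<and> P y}"
  by (induction w) auto

lemma fixed_pairs_total:
  assumes "x \<in> set w" "y \<in> set w" "x \<noteq> y" "\<not> consecutive x y"
  shows "(x, y) \<in> fixed_pairs w \<or> (y, x) \<in> fixed_pairs w"
  using assms by (induction w) (auto simp: consecutive_commute)

text \<open>The only pair of letters whose relative order a swap changes is a consecutive one, which
  \<open>fixed_pairs\<close> does not record.\<close>

lemma adj_swap_fixed_pairs: "adj_swap u v \<Longrightarrow> fixed_pairs u = fixed_pairs v"
  by (induction rule: adj_swap.induct)
     (auto simp: fixed_pairs_append consecutive_iff_abs abs_minus_commute)

lemma adj_swap_Cons:
  assumes "adj_swap u v"
  shows "adj_swap (x # u) (x # v)"
  using assms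
proof cases
  case (1 a b xs ys)
  then show ?thesis
    using adj_swap.intros[of a b "x # xs" ys] by simp
qed

lemma adj_swap_rtranclp_Cons: "adj_swap\<^sup>*\<^sup>* u v \<Longrightarrow> adj_swap\<^sup>*\<^sup>* (x # u) (x # v)"
  by (induction rule: rtranclp_induct) (auto intro: rtranclp.rtrancl_into_rtrancl adj_swap_Cons)

lemma adj_swap_to_front:
  assumes "\<forall>y\<in>set p. consecutive y x"
  shows "adj_swap\<^sup>*\<^sup>* (p @ x # q) (x # p @ q)"
  using assms
proof (induction p)
  case (Cons y p)
  then have "adj_swap\<^sup>*\<^sup>* (y # p @ x # q) (y # x # p @ q)"
    by (simp add: adj_swap_rtranclp_Cons)
  moreover have "adj_swap (y # x # p @ q) (x # y # p @ q)"
    using adj_swap.intros[of y x "[]" "p @ q"] Cons.prems by (simp add: consecutive_iff_abs)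
  ultimately show ?case
    by simp
qed simp

text \<open>Completeness of the invariant. If the target word starts with \<open>x\<close>, then
  every letter standing before \<open>x\<close> in \<open>v\<close> commutes with \<open>x\<close>,
  since otherwise it would form a pair ending in \<open>x\<close>. So \<open>x\<close> slides to the
  front of \<open>v\<close>; deleting it from both words keeps the invariants equal, and the
  induction continues.\<close>

lemma adj_swap_rtranclp_if_fixed_pairs_eq:
  assumes "distinct u" "distinct v" "set u = set v" "fixed_pairs u = fixed_pairs v"
  shows "adj_swap\<^sup>*\<^sup>* v u"
  using assms
proof (induction u arbitrary: v)
  case (Cons x u)
  then obtain p q where v: "v = p @ x # q"
    by (metis list.set_intros(1) split_list)
  have "consecutive y x" if "y \<in> set p" for y
  proof (rule ccontr)
    assume "\<not> consecutive y x"
    with that have "(y, x) \<in> fixed_pairs (x # u)"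
      unfolding Cons.prems(4) v by (auto simp: fixed_pairs_append)
    then show False
      using Cons.prems(1,2) that v by (auto dest: fixed_pairsD)
  qed
  then have front: "adj_swap\<^sup>*\<^sup>* v (x # p @ q)"
    using adj_swap_to_front v by blast
  have "filter (\<lambda>y. y \<noteq> x) (x # u) = u" "filter (\<lambda>y. y \<noteq> x) v = p @ q"
    using Cons.prems(1,2) v by (auto simp: filter_id_conv intro!: arg_cong2[where f = "(@)"])
  then have "fixed_pairs u = fixed_pairs (p @ q)"
    using Cons.prems(4) fixed_pairs_filter[of "\<lambda>y. y \<noteq> x" "x # u"]
      fixed_pairs_filter[of "\<lambda>y. y \<noteq> x" v] by simp
  moreover have "set u = set (p @ q)"
    using Cons.prems(1-3) v by auto
  ultimately have "adj_swap\<^sup>*\<^sup>* (p @ q) u"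
    using Cons.IH Cons.prems(1,2) v by auto
  with front show ?case
    by (meson adj_swap_rtranclp_Cons rtranclp_trans)
qed simp

lemma swap_equiv_iff_fixed_pairs:
  assumes "u \<in> perm_words n" "v \<in> perm_words n"
  shows "(u, v) \<in> swap_equiv n \<longleftrightarrow> fixed_pairs u = fixed_pairs v"
proof
  assume "(u, v) \<in> swap_equiv n"
  then have "adj_swap\<^sup>*\<^sup>* u v"
    by (simp add: swap_equiv_def)
  then show "fixed_pairs u = fixed_pairs v"
    by (induction rule: rtranclp_induct) (auto dest: adj_swap_fixed_pairs)
next
  assume "fixed_pairs u = fixed_pairs v"
  then show "(u, v) \<in> swap_equiv n"
    using adj_swap_rtranclp_if_fixed_pairs_eq[of v u] assms
    by (auto simp: swap_equiv_def permutations_of_set_def)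
qed

section \<open>Classes counted through the letters that can come first\<close>

definition class_orders :: "nat set \<Rightarrow> (nat \<times> nat) set set" where
  "class_orders A = fixed_pairs ` permutations_of_set A"

lemma finite_class_orders [simp]: "finite (class_orders A)"
  by (simp add: class_orders_def)

lemma class_orders_empty [simp]: "class_orders {} = {{}}"
  by (simp add: class_orders_def)

text \<open>The case \<open>n = 0\<close> fits too: the empty word is the only arrangement, which
  agrees with the convention f(0) = 1.\<close>

lemma num_classes_eq: "num_classes n = card (class_orders {1..n})"
proof -
  have "bij_betw (\<lambda>X. the_elem (fixed_pairs ` X)) (perm_words n // swap_equiv n)
          (class_orders {1..n})"
  proof -
    \<comment> \<open>The invariant is constant on a class, so its image is a singleton and
      \<open>the_elem\<close> returns its value.\<close>
    have image: "the_elem (fixed_pairs ` (swap_equiv n `` {u})) = fixed_pairs u"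
      if "u \<in> perm_words n" for u
    proof -
      have "v \<in> perm_words n" if "(u, v) \<in> swap_equiv n" for v
        using that by (simp add: swap_equiv_def)
      moreover have "(u, u) \<in> swap_equiv n"
        using that by (simp add: swap_equiv_def)
      ultimately have "fixed_pairs ` (swap_equiv n `` {u}) = {fixed_pairs u}"
        using swap_equiv_iff_fixed_pairs that by blast
      then show ?thesis by simp
    qed
    have "swap_equiv n `` {u} = swap_equiv n `` {v}"
      if "u \<in> perm_words n" "v \<in> perm_words n" "fixed_pairs u = fixed_pairs v" for u v
      using that swap_equiv_iff_fixed_pairs equiv_class_eq[OF equiv_swap_equiv] by blast
    then have "inj_on (\<lambda>X. the_elem (fixed_pairs ` X)) (perm_words n // swap_equiv n)"
      unfolding inj_on_def by (metis image quotientE)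
    moreover have "perm_words n // swap_equiv n = (\<lambda>u. swap_equiv n `` {u}) ` perm_words n"
      by (auto simp: quotient_def)
    then have "(\<lambda>X. the_elem (fixed_pairs ` X)) ` (perm_words n // swap_equiv n) = class_orders {1..n}"
      using image by (simp add: class_orders_def image_image)
    ultimately show ?thesis
      by (simp add: bij_betw_def)
  qed
  then show ?thesis
    by (auto simp: num_classes_def dest: bij_betw_same_card)
qed

text \<open>For \<open>R\<close> in \<open>class_orders A\<close> these are the letters that can be
  moved to the front of the class.\<close>

definition minimal_elems :: "nat set \<Rightarrow> (nat \<times> nat) set \<Rightarrow> nat set" where
  "minimal_elems A R = {x \<in> A. \<forall>y. (y, x) \<notin> R}"

text \<open>Letters of \<open>S\<close> commute with each other, so a class in which each can come
  first is \<open>S\<close>, in any order, followed by a class on \<open>A - S\<close>. The map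
  \<open>f\<close> forgets \<open>S\<close>; \<open>g\<close> restores the pairs that putting
  \<open>S\<close> first forces.\<close>

lemma card_class_orders_minimal:
  assumes "finite A" "S \<subseteq> A" and clique: "\<forall>x\<in>S. \<forall>y\<in>S. x \<noteq> y \<longrightarrow> consecutive x y"
  shows "card {R \<in> class_orders A. S \<subseteq> minimal_elems A R} = card (class_orders (A - S))"
proof -
  define f where "f R = R \<inter> (A - S) \<times> (A - S)" for R :: "(nat \<times> nat) set"
  define g where "g R = R \<union> {(s, y). s \<in> S \<and> y \<in> A - S \<and> \<not> consecutive s y}" for R
  have "bij_betw f {R \<in> class_orders A. S \<subseteq> minimal_elems A R} (class_orders (A - S))"
  proof (rule bij_betw_byWitness[where f' = g])
    show "\<forall>R\<in>{R \<in> class_orders A. S \<subseteq> minimal_elems A R}. g (f R) = R"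
    proof
      fix R assume "R \<in> {R \<in> class_orders A. S \<subseteq> minimal_elems A R}"
      then obtain w where w: "distinct w" "set w = A" "R = fixed_pairs w"
        and S: "S \<subseteq> minimal_elems A R"
        by (auto simp: class_orders_def permutations_of_set_def)
      \<comment> \<open>Minimality rules out pairs ending in \<open>S\<close>, so totality orients
        every non-commuting pair between \<open>S\<close> and \<open>A - S\<close> away from
        \<open>S\<close>.\<close>
      have "(x, y) \<in> R \<longleftrightarrow> (x, y) \<in> g (f R)" for x y
        using fixed_pairsD[of x y w] fixed_pairs_total[of x w y] w assms(2) S
        unfolding f_def g_def minimal_elems_def by auto
      then show "g (f R) = R" by auto
    qed
    show "\<forall>R\<in>class_orders (A - S). f (g R) = R"
      by (auto simp: class_orders_def permutations_of_set_def f_def g_def dest: fixed_pairsD)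
    show "f ` {R \<in> class_orders A. S \<subseteq> minimal_elems A R} \<subseteq> class_orders (A - S)"
    proof
      fix R assume "R \<in> f ` {R \<in> class_orders A. S \<subseteq> minimal_elems A R}"
      then obtain w where w: "distinct w" "set w = A" "R = f (fixed_pairs w)"
        by (auto simp: class_orders_def permutations_of_set_def)
      then have "R = fixed_pairs (filter (\<lambda>x. x \<notin> S) w)"
        by (auto simp: f_def fixed_pairs_filter dest: fixed_pairsD)
      moreover have "filter (\<lambda>x. x \<notin> S) w \<in> permutations_of_set (A - S)"
        using w by (auto simp: permutations_of_set_def)
      ultimately show "R \<in> class_orders (A - S)"
        by (simp add: class_orders_def)
    qed
    show "g ` class_orders (A - S) \<subseteq> {R \<in> class_orders A. S \<subseteq> minimal_elems A R}"
    proof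
      fix R assume "R \<in> g ` class_orders (A - S)"
      then obtain w where w: "distinct w" "set w = A - S" "R = g (fixed_pairs w)"
        by (auto simp: class_orders_def permutations_of_set_def)
      obtain s where s: "set s = S" "distinct s"
        using finite_distinct_list finite_subset[OF assms(2,1)] by blast
      have "fixed_pairs s = {}"
        using s clique
      proof (induction s arbitrary: S)
        case (Cons a s)
        then show ?case by auto
      qed simp
      then have "R = fixed_pairs (s @ w)"
        using w s by (auto simp: fixed_pairs_append g_def)
      moreover have "s @ w \<in> permutations_of_set A"
        using w s assms(2) by (auto simp: permutations_of_set_def)
      moreover have "S \<subseteq> minimal_elems A R"
        using w assms(2) by (auto simp: g_def minimal_elems_def dest: fixed_pairsD)
      ultimately show "R \<in> {R \<in> class_orders A. S \<subseteq> minimal_elems A R}"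
        by (simp add: class_orders_def)
    qed
  qed
  then show ?thesis
    by (rule bij_betw_same_card)
qed

text \<open>The first letter of any representing word is minimal. Minimal letters are pairwise
  consecutive, and no three distinct integers are. Hence the difference is 1 - 0 for one minimal
  letter and 2 - 1 for two.\<close>

lemma card_minimal_elems:
  assumes "finite A" "A \<noteq> {}" "R \<in> class_orders A"
  shows "int (card (minimal_elems A R)) - int (card {x \<in> A. {x, Suc x} \<subseteq> minimal_elems A R}) = 1"
proof -
  let ?I = "minimal_elems A R"
  obtain w where w: "distinct w" "set w = A" "R = fixed_pairs w"
    using assms(3) by (auto simp: class_orders_def permutations_of_set_def)
  then obtain a w' where "w = a # w'"
    using assms(2) by (cases w) auto
  then have a: "a \<in> ?I"
    using w by (auto simp: minimal_elems_def dest: fixed_pairsD)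
  have clique: "consecutive x y" if "x \<in> ?I" "y \<in> ?I" "x \<noteq> y" for x y
    using that fixed_pairs_total[of x w y] w by (auto simp: minimal_elems_def)
  have sub: "?I \<subseteq> A"
    by (auto simp: minimal_elems_def)
  consider "?I = {a}" | b where "?I = {b, Suc b}"
  proof (cases "?I = {a}")
    case False
    with a obtain b where b: "b \<in> ?I" "b \<noteq> a" by blast
    have "?I = {a, b}"
    proof (rule ccontr)
      assume "?I \<noteq> {a, b}"
      with a b obtain c where "c \<in> ?I" "c \<noteq> a" "c \<noteq> b" by blast
      then show False
        using a b clique[of a b] clique[of a c] clique[of b c] by (auto simp: consecutive_def)
    qed
    moreover have "b = Suc a \<or> a = Suc b"
      using a b clique[of a b] by (auto simp: consecutive_def)
    ultimately show ?thesis
      using that(2) by (metis insert_commute)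
  qed (use that in blast)
  then show ?thesis
  proof cases
    case 1
    then have "{x \<in> A. {x, Suc x} \<subseteq> ?I} = {}" by auto
    then show ?thesis by (simp only: 1) simp
  next
    case 2
    then have "{x \<in> A. {x, Suc x} \<subseteq> ?I} = {b}" using sub by auto
    then show ?thesis by (simp only: 2) simp
  qed
qed

text \<open>Sum \<open>card_minimal_elems\<close> over all classes and exchange the sums;
  \<open>card_class_orders_minimal\<close> then evaluates the counts for the cliques
  \<open>{x}\<close> and \<open>{x, Suc x}\<close>.\<close>

lemma card_class_orders_rec:
  assumes "finite A" "A \<noteq> {}"
  shows "int (card (class_orders A)) =
     (\<Sum>x\<in>A. int (card (class_orders (A - {x})))) -
     (\<Sum>x | x \<in> A \<and> Suc x \<in> A. int (card (class_orders (A - {x, Suc x}))))"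
proof -
  have "(\<Sum>x\<in>A. card (class_orders (A - {x}))) =
      (\<Sum>x\<in>A. \<Sum>R | R \<in> class_orders A \<and> x \<in> minimal_elems A R. 1)"
  proof (rule sum.cong[OF refl])
    fix x assume "x \<in> A"
    then show "card (class_orders (A - {x})) =
        (\<Sum>R | R \<in> class_orders A \<and> x \<in> minimal_elems A R. 1)"
      using card_class_orders_minimal[OF assms(1), of "{x}"] by simp
  qed
  also have "\<dots> = (\<Sum>R\<in>class_orders A. \<Sum>x | x \<in> A \<and> x \<in> minimal_elems A R. 1)"
    using assms(1) by (intro sum.swap_restrict) simp_all
  also have "\<dots> = (\<Sum>R\<in>class_orders A. card (minimal_elems A R))"
    by (simp add: minimal_elems_def)
  finally have 1: "(\<Sum>x\<in>A. card (class_orders (A - {x}))) = \<dots>" .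
  have "(\<Sum>x | x \<in> A \<and> Suc x \<in> A. card (class_orders (A - {x, Suc x}))) =
      (\<Sum>x | x \<in> A \<and> Suc x \<in> A. \<Sum>R | R \<in> class_orders A \<and> {x, Suc x} \<subseteq> minimal_elems A R. 1)"
  proof (rule sum.cong[OF refl], clarify)
    fix x assume "x \<in> A" "Suc x \<in> A"
    then show "card (class_orders (A - {x, Suc x})) =
        (\<Sum>R | R \<in> class_orders A \<and> {x, Suc x} \<subseteq> minimal_elems A R. 1)"
      using card_class_orders_minimal[OF assms(1), of "{x, Suc x}"] by (simp add: consecutive_def)
  qed
  also have "\<dots> = (\<Sum>R\<in>class_orders A.
      \<Sum>x | x \<in> {x. x \<in> A \<and> Suc x \<in> A} \<and> {x, Suc x} \<subseteq> minimal_elems A R. 1)"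
    using assms(1) by (intro sum.swap_restrict) simp_all
  also have "\<dots> = (\<Sum>R\<in>class_orders A. card {x \<in> A. {x, Suc x} \<subseteq> minimal_elems A R})"
  proof (rule sum.cong[OF refl])
    fix R
    have "{x. x \<in> {x. x \<in> A \<and> Suc x \<in> A} \<and> {x, Suc x} \<subseteq> minimal_elems A R} =
        {x \<in> A. {x, Suc x} \<subseteq> minimal_elems A R}"
      by (auto simp: minimal_elems_def)
    then show "(\<Sum>x | x \<in> {x. x \<in> A \<and> Suc x \<in> A} \<and> {x, Suc x} \<subseteq> minimal_elems A R. 1) =
        card {x \<in> A. {x, Suc x} \<subseteq> minimal_elems A R}"
      by (simp only: card_eq_sum)
  qed
  finally have 2: "(\<Sum>x | x \<in> A \<and> Suc x \<in> A. card (class_orders (A - {x, Suc x}))) = \<dots>" .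
  have "int (card (class_orders A)) = (\<Sum>R\<in>class_orders A. int (card (minimal_elems A R)) -
      int (card {x \<in> A. {x, Suc x} \<subseteq> minimal_elems A R}))"
    using card_minimal_elems[OF assms] by simp
  also have "\<dots> = int (\<Sum>R\<in>class_orders A. card (minimal_elems A R)) -
      int (\<Sum>R\<in>class_orders A. card {x \<in> A. {x, Suc x} \<subseteq> minimal_elems A R})"
    by (simp add: sum_subtractf)
  finally show ?thesis
    unfolding 1[symmetric] 2[symmetric] by simp
qed

section \<open>Signed sums over matchings and their recursion\<close>

text \<open>A matching of the path graph on \<open>A\<close> is encoded by the lower endpoints of its edges.\<close>

definition matchings :: "nat set \<Rightarrow> nat set set" where
  "matchings A = {M. \<forall>x\<in>M. x \<in> A \<and> Suc x \<in> A \<and> Suc x \<notin> M}"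

lemma matchings_subset_Pow: "matchings A \<subseteq> Pow A"
  by (auto simp: matchings_def)

lemma finite_matchings [simp]: "finite A \<Longrightarrow> finite (matchings A)"
  by (rule finite_subset[OF matchings_subset_Pow]) simp

lemma finite_in_matchings: "finite A \<Longrightarrow> M \<in> matchings A \<Longrightarrow> finite M"
  using matchings_subset_Pow finite_subset by blast

lemma matchings_empty [simp]: "matchings {} = {{}}"
  by (auto simp: matchings_def)

lemma matchings_remove1:
  "matchings (A - {x}) = {M \<in> matchings A. x \<notin> M \<union> Suc ` M}"
  by (auto simp: matchings_def)

lemma card_uncovered:
  assumes "finite A" "M \<in> matchings A"
  shows "card (A - (M \<union> Suc ` M)) + 2 * card M = card A"
proof -
  have fin: "finite M"
    using assms finite_in_matchings by blast
  have "M \<union> Suc ` M \<subseteq> A" "M \<inter> Suc ` M = {}"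
    using assms(2) by (auto simp: matchings_def)
  moreover have "card (M \<union> Suc ` M) = 2 * card M"
    using fin \<open>M \<inter> Suc ` M = {}\<close> by (simp add: card_Un_disjoint card_image)
  ultimately show ?thesis
    using assms(1) fin card_mono[of A "M \<union> Suc ` M"] by (simp add: card_Diff_subset)
qed

definition signed_matchings :: "nat set \<Rightarrow> int" where
  "signed_matchings A = (\<Sum>M\<in>matchings A. (-1) ^ card M * fact (card A - card M))"

lemma signed_matchings_empty [simp]: "signed_matchings {} = 1"
  by (simp add: signed_matchings_def)

text \<open>
  A matching with \<open>k\<close> blocks (edges and isolated points) contributes \<open>k!\<close>, the number of
  orderings of its blocks; splitting off the first block gives the recursion.
\<close>

lemma signed_matchings_rec:
  assumes "finite A" "A \<noteq> {}"
  shows "signed_matchings A =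
     (\<Sum>x\<in>A. signed_matchings (A - {x})) -
     (\<Sum>x | x \<in> A \<and> Suc x \<in> A. signed_matchings (A - {x, Suc x}))"
proof -
  \<comment> \<open>This weight serves both sums: deleting an isolated point lowers
    \<open>card A\<close> by one, while deleting an edge lowers \<open>card A\<close> by two and the
    edge count by one, which also flips the sign.\<close>
  let ?c = "\<lambda>M. (-1) ^ card M * fact (card A - 1 - card M) :: int"
  have "(\<Sum>x\<in>A. signed_matchings (A - {x})) =
      (\<Sum>x\<in>A. \<Sum>M | M \<in> matchings A \<and> x \<notin> M \<union> Suc ` M. ?c M)"
    using assms(1) by (intro sum.cong refl) (simp add: signed_matchings_def matchings_remove1)
  also have "\<dots> = (\<Sum>M\<in>matchings A. \<Sum>x | x \<in> A \<and> x \<notin> M \<union> Suc ` M. ?c M)"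
    using assms(1) by (intro sum.swap_restrict) simp_all
  also have "\<dots> = (\<Sum>M\<in>matchings A. int (card (A - (M \<union> Suc ` M))) * ?c M)"
    by (simp add: set_diff_eq)
  finally have 1: "(\<Sum>x\<in>A. signed_matchings (A - {x})) = \<dots>" .
  \<comment> \<open>A matching using the edge from \<open>x\<close> to \<open>Suc x\<close> has no
    other edge at either endpoint, so its remaining edges avoid both.\<close>
  have insert_bij: "bij_betw (insert x) (matchings (A - {x, Suc x})) {M \<in> matchings A. x \<in> M}"
    if "x \<in> A" "Suc x \<in> A" for x
    by (rule bij_betw_byWitness[where f' = "\<lambda>M. M - {x}"])
       (use that in \<open>auto simp: matchings_def\<close>)
  have "(\<Sum>x | x \<in> A \<and> Suc x \<in> A. signed_matchings (A - {x, Suc x})) =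
      (\<Sum>x | x \<in> A \<and> Suc x \<in> A. \<Sum>M | M \<in> matchings A \<and> x \<in> M. - ?c M)"
  proof (rule sum.cong[OF refl], clarify)
    fix x assume x: "x \<in> A" "Suc x \<in> A"
    have "(-1) ^ card M * fact (card (A - {x, Suc x}) - card M) = - ?c (insert x M)"
      if "M \<in> matchings (A - {x, Suc x})" for M
    proof -
      have "finite M" "x \<notin> M"
        using that assms(1) finite_in_matchings[of "A - {x, Suc x}" M]
        by (auto simp: matchings_def)
      moreover have "card (A - {x, Suc x}) = card A - 2"
        using x by (simp add: card_Diff_subset)
      ultimately show ?thesis by simp
    qed
    then have "signed_matchings (A - {x, Suc x}) =
        (\<Sum>M\<in>matchings (A - {x, Suc x}). - ?c (insert x M))"
      unfolding signed_matchings_def by (intro sum.cong) auto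
    also have "\<dots> = (\<Sum>M | M \<in> matchings A \<and> x \<in> M. - ?c M)"
      by (rule sum.reindex_bij_betw[OF insert_bij[OF x]])
    finally show "signed_matchings (A - {x, Suc x}) = \<dots>" .
  qed
  also have "\<dots> = (\<Sum>M\<in>matchings A. \<Sum>x | (x \<in> A \<and> Suc x \<in> A) \<and> x \<in> M. - ?c M)"
    using assms(1) sum.swap_restrict[of "{x. x \<in> A \<and> Suc x \<in> A}" "matchings A"
        "\<lambda>_ M. - ?c M" "\<lambda>x M. x \<in> M"] by simp
  also have "\<dots> = (\<Sum>M\<in>matchings A. - (int (card M) * ?c M))"
  proof (rule sum.cong[OF refl])
    fix M assume "M \<in> matchings A"
    then have "{x. (x \<in> A \<and> Suc x \<in> A) \<and> x \<in> M} = M"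
      by (auto simp: matchings_def)
    then show "(\<Sum>x | (x \<in> A \<and> Suc x \<in> A) \<and> x \<in> M. - ?c M) = - (int (card M) * ?c M)"
      by simp
  qed
  finally have 2: "(\<Sum>x | x \<in> A \<and> Suc x \<in> A. signed_matchings (A - {x, Suc x})) = \<dots>" .
  have "signed_matchings A = (\<Sum>M\<in>matchings A.
      int (card (A - (M \<union> Suc ` M))) * ?c M - - (int (card M) * ?c M))"
    unfolding signed_matchings_def
  proof (rule sum.cong[OF refl])
    fix M assume "M \<in> matchings A"
    then have card: "card (A - (M \<union> Suc ` M)) + 2 * card M = card A"
      by (rule card_uncovered[OF assms(1)])
    moreover have "card A > 0"
      using assms by (simp add: card_gt_0_iff)
    \<comment> \<open>A matching of a nonempty set has fewer edges than points, so no subtraction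
      truncates. There are \<open>Suc k\<close> blocks, and the claim becomes (k + 1)! = (k + 1)
      k!.\<close>
    ultimately obtain k where k: "card A = Suc (card M + k)"
      using less_imp_Suc_add[of "card M" "card A"] by fastforce
    then have "int (card (A - (M \<union> Suc ` M))) + int (card M) = int (Suc k)"
      using card by linarith
    then show "(-1) ^ card M * fact (card A - card M) =
        int (card (A - (M \<union> Suc ` M))) * ?c M - - (int (card M) * ?c M)"
      using k by (simp add: fact_Suc flip: distrib_right)
  qed
  then show ?thesis
    unfolding 1 2 sum_subtractf .
qed

section \<open>Matchings of an interval, counted by number of edges\<close>

text \<open>Split on the last edge, encoded by \<open>Suc n\<close>: if it is used, the rest lives
  on \<open>{1..n}\<close>; otherwise the last point is isolated.\<close>

lemma matchings_atLeastAtMost_Suc_Suc: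
  "matchings {1..Suc (Suc n)} =
     matchings {1..Suc n} \<union> insert (Suc n) ` matchings {1..n}"
proof (intro equalityI subsetI)
  fix M assume M: "M \<in> matchings {1..Suc (Suc n)}"
  show "M \<in> matchings {1..Suc n} \<union> insert (Suc n) ` matchings {1..n}"
  proof (cases "Suc n \<in> M")
    case True
    have "x \<le> n \<and> Suc x \<le> n" if "x \<in> M" "x \<noteq> Suc n" for x
      using that M True by (force simp: matchings_def le_Suc_eq)
    then have "M - {Suc n} \<in> matchings {1..n}"
      using M by (auto simp: matchings_def)
    then show ?thesis
      using True by (metis UnI2 image_eqI insert_Diff)
  next
    case False
    then have "x \<noteq> Suc n" if "x \<in> M" for x
      using that by auto
    then show ?thesis
      using M by (force simp: matchings_def le_Suc_eq)
  qed
next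
  fix M assume "M \<in> matchings {1..Suc n} \<union> insert (Suc n) ` matchings {1..n}"
  then show "M \<in> matchings {1..Suc (Suc n)}"
    by (force simp: matchings_def)
qed

lemma card_matchings_atLeastAtMost:
  "card {M \<in> matchings {1..n}. card M = j} = (n - j) choose j"
proof (induction n arbitrary: j rule: induct_nat_012)
  case 0
  have "{M \<in> matchings {1..0}. card M = j} = (if j = 0 then {{}} else {})"
    by auto
  then show ?case by simp
next
  case 1
  have single: "matchings {1..Suc 0} = {{}}"
    by (auto simp: matchings_def)
  have "{M \<in> matchings {1..Suc 0}. card M = j} = (if j = 0 then {{}} else {})"
    unfolding single by auto
  then show ?case by (cases j) auto
next
  case (ge2 n)
  show ?case
  proof (cases j)
    case 0
    \<comment> \<open>Finiteness matters here, as infinite sets also have \<open>card\<close> equal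
      to 0.\<close>
    have empty: "M \<in> {{}}" if "M \<in> matchings {1..Suc (Suc n)}" "card M = 0" for M
      using that finite_in_matchings[of "{1..Suc (Suc n)}" M] by simp
    have "{} \<in> matchings {1..Suc (Suc n)}"
      by (simp add: matchings_def)
    then have "{M \<in> matchings {1..Suc (Suc n)}. card M = 0} = {{}}"
      using empty by (intro equalityI subsetI) (blast, simp)
    then show ?thesis by (simp only: 0) simp
  next
    case (Suc i)
    have notin: "Suc n \<notin> M" if "M \<in> matchings {1..n} \<union> matchings {1..Suc n}" for M
      using that by (auto simp: matchings_def)
    have "{M \<in> matchings {1..Suc (Suc n)}. card M = j} =
        {M \<in> matchings {1..Suc n}. card M = j} \<union>
        insert (Suc n) ` {M \<in> matchings {1..n}. card M = i}"
      using notin finite_in_matchings[of "{1..n}"]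
      unfolding matchings_atLeastAtMost_Suc_Suc Suc by auto
    moreover have "{M \<in> matchings {1..Suc n}. card M = j} \<inter>
        insert (Suc n) ` {M \<in> matchings {1..n}. card M = i} = {}"
      using notin by auto
    moreover have "card (insert (Suc n) ` {M \<in> matchings {1..n}. card M = i}) =
        card {M \<in> matchings {1..n}. card M = i}"
      using notin by (intro card_image inj_onI) (metis (lifting) Un_iff insert_ident mem_Collect_eq)
    ultimately have "card {M \<in> matchings {1..Suc (Suc n)}. card M = j} =
        (Suc n - j choose j) + (n - i choose i)"
      by (simp add: card_Un_disjoint ge2.IH[simplified])
    \<comment> \<open>For \<open>i \<le> n\<close> this is Pascal's rule; otherwise all the
      differences truncate to 0 and every binomial coefficient vanishes.\<close>
    also have "\<dots> = Suc (Suc n) - j choose j"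
      unfolding Suc by (cases "i \<le> n") (auto simp: Suc_diff_le)
    finally show ?thesis .
  qed
qed

lemma signed_matchings_atLeastAtMost:
  "signed_matchings {1..n} =
     (\<Sum>j = 0..n div 2. (-1) ^ j * fact (n - j) * int ((n - j) choose j))"
proof -
  have "card M \<in> {0..n div 2}" if "M \<in> matchings {1..n}" for M
    using card_uncovered[OF _ that] by simp
  then have "signed_matchings {1..n} =
      (\<Sum>j = 0..n div 2. \<Sum>M | M \<in> matchings {1..n} \<and> card M = j. (-1) ^ card M * fact (n - card M))"
    unfolding signed_matchings_def by (subst sum.group) auto
  also have "\<dots> = (\<Sum>j = 0..n div 2. (-1) ^ j * fact (n - j) * int ((n - j) choose j))"
    by (intro sum.cong refl) (simp add: card_matchings_atLeastAtMost[simplified])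
  finally show ?thesis .
qed

section \<open>The generating function\<close>

lemma fps_nth_one_minus_X_power:
  "fps_nth ((1 - fps_X) ^ m :: 'a :: comm_ring_1 fps) k = (-1) ^ k * of_nat (m choose k)"
proof (induction m arbitrary: k)
  case 0
  show ?case by (cases k) auto
next
  case (Suc m)
  have "(1 - fps_X) ^ Suc m = (1 - fps_X) ^ m - fps_X * (1 - fps_X :: 'a fps) ^ m"
    by (simp add: left_diff_distrib)
  then have "fps_nth ((1 - fps_X) ^ Suc m :: 'a fps) k =
      fps_nth ((1 - fps_X) ^ m) k - (if k = 0 then 0 else fps_nth ((1 - fps_X) ^ m) (k - 1))"
    by (simp only: fps_sub_nth fps_X_mult_nth)
  also have "\<dots> = (-1) ^ k * of_nat (Suc m choose k)"
    unfolding Suc.IH by (cases k) (simp_all add: distrib_left)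
  finally show ?case .
qed

text \<open>The factor \<open>fps_X ^ m\<close> shifts the binomial expansion by \<open>m\<close>.
  With m = n - j this is the term of index \<open>j\<close> in the formula.\<close>

lemma fps_nth_fact_X_power:
  "fps_nth (fact m * (fps_X * (1 - fps_X)) ^ m :: int fps) n =
     (if n < m then 0 else (-1) ^ (n - m) * fact m * int (m choose (n - m)))"
proof -
  have "(fact m :: int fps) = fps_const (fact m)"
    by (metis fps_of_nat of_nat_fact)
  then show ?thesis
    by (simp add: power_mult_distrib fps_X_power_mult_nth fps_nth_one_minus_X_power)
qed

text \<open>Convergence of power series follows once each coefficient is eventually constant. Term
  \<open>m\<close> has no coefficient below degree \<open>m\<close>, so coefficient \<open>n\<close>
  of a partial sum is final once \<open>N > n\<close>.\<close>

lemma sums_fact_X_power: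
  "(\<lambda>m. fact m * (fps_X * (1 - fps_X)) ^ m) sums
     Abs_fps (\<lambda>n. \<Sum>j = 0..n div 2. (-1) ^ j * fact (n - j) * int ((n - j) choose j))"
  unfolding sums_def
proof (rule tendsto_fpsI)
  fix n
  let ?t = "\<lambda>m. fact m * (fps_X * (1 - fps_X)) ^ m :: int fps"
  let ?a = "\<lambda>j. (-1) ^ j * fact (n - j) * int ((n - j) choose j)"
  have "fps_nth (\<Sum>m<N. ?t m) n = (\<Sum>j = 0..n div 2. ?a j)" if "N > n" for N
  proof -
    have "fps_nth (\<Sum>m<N. ?t m) n = (\<Sum>m\<le>n. fps_nth (?t m) n)"
      unfolding fps_sum_nth using that
      by (intro sum.mono_neutral_right) (auto simp: fps_nth_fact_X_power)
    also have "\<dots> = (\<Sum>m\<le>n. ?a (n - m))"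
      by (intro sum.cong) (auto simp: fps_nth_fact_X_power)
    also have "\<dots> = (\<Sum>j\<le>n. ?a j)"
      using sum.nat_diff_reindex[of ?a "Suc n"] by (simp add: lessThan_Suc_atMost)
    \<comment> \<open>For j > n div 2 the upper index n - j is below \<open>j\<close>, so the
      binomial coefficient is 0.\<close>
    also have "\<dots> = (\<Sum>j = 0..n div 2. ?a j)"
      by (intro sum.mono_neutral_right) auto
    finally show ?thesis .
  qed
  then show "\<forall>\<^sub>F N in sequentially. fps_nth (\<Sum>m<N. ?t m) n =
      fps_nth (Abs_fps (\<lambda>n. \<Sum>j = 0..n div 2. (-1) ^ j * fact (n - j) * int ((n - j) choose j))) n"
    unfolding fps_nth_Abs_fps by (rule eventually_mono[OF eventually_gt_at_top[of n]])
qed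

section \<open>The two recursions compared\<close>

text \<open>Both sides are 1 on the empty set and obey the same recursion, whose terms involve only
  proper subsets of \<open>A\<close>.\<close>

lemma card_class_orders: "finite A \<Longrightarrow> int (card (class_orders A)) = signed_matchings A"
proof (induction A rule: finite_psubset_induct)
  case (psubset A)
  show ?case
  proof (cases "A = {}")
    case False
    have "int (card (class_orders (A - {x}))) = signed_matchings (A - {x})"
      "int (card (class_orders (A - {x, Suc x}))) = signed_matchings (A - {x, Suc x})"
      if "x \<in> A" for x
      using that by (intro psubset.IH; blast)+
    then show ?thesis
      unfolding card_class_orders_rec[OF psubset.hyps False]
        signed_matchings_rec[OF psubset.hyps False]
      by (intro arg_cong2[where f = "(-)"] sum.cong) auto
  qed simp
qed

lemma num_classes_formula:
  "int (num_classes n) =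
     (\<Sum>j = 0..n div 2. (-1) ^ j * fact (n - j) * int ((n - j) choose j))"
  unfolding num_classes_eq
  by (simp only: card_class_orders finite_atLeastAtMost signed_matchings_atLeastAtMost)

theorem theorem2p2:
  shows "(\<forall>n. int (num_classes n) =
            (\<Sum>j = 0..n div 2. (- 1) ^ j * fact (n - j) * int ((n - j) choose j)))
       \<and> (\<lambda>m. fact m * (fps_X * (1 - fps_X)) ^ m) sums Abs_fps (\<lambda>n. int (num_classes n))"
  using sums_fact_X_power by (simp only: num_classes_formula simp_thms)

end
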